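(* Let $q\colon M\to L$ be a compactification, and let $h\in\mathcal R_0L$ with $h\ge0$. Then $h\in\mathcal E_0q$ if and only if for every positive integer $n$ the truncation $h\wedge n$ factors through $q$, i.e. $h\wedge n=q\circ\hat h_n$ for some $\hat h_n\in\mathcal R_0M$.
   Context: A pointed frame is a frame $L$ with a frame homomorphism $*_L\colon L\to2=\{\bot,\top\}$; pointed frame homomorphisms are frame homomorphisms commuting with the points. $\mathcal O_*\mathbb R$, $\mathcal O_*\overline{\mathbb R}$ are the frames of open sets of $\mathbb R$ and $\overline{\mathbb R}=[-\infty,\infty]$ pointed by $0$ ($*(U)=\top$ iff $0\in U$); $p\colon\mathcal O_*\overline{\mathbb R}\to\mathcal O_*\mathbb R$ is $U\mapsto U\cap(-\infty,\infty)$. $\mathcal R_0L$ is the set of pointed frame homomorphisms $\mathcal O_*\mathbb R\to L$. It is an archimedean vector lattice with a truncation $g\mapsto\overline g$ on its positive cone, each operation $w\colon\mathbb R^n\to\mathbb R$ (addition, scalar multiplication, $\vee$, $\wedge$, truncation $x\mapsto x\wedge1$) acting by $w(f_1,\dots,f_n)(V)=\bigvee\{\bigwedge_if_i(U_i):w(U_1\times\dots\times U_n)\subseteq V\}$. For $h\ge0$, $h\wedge n$ denotes $n\,\overline{h/n}$. A compactification is a dense ($q(x)=\bot\Rightarrow x=\bot$) surjective pointed frame homomorphism $q\colon M\to L$ with $M$ compact regular. $\mathcal D_0M$ is the set of pointed frame homomorphisms $h'\colon\mathcal O_*\overline{\mathbb R}\to M$ such that $h'(-\infty,\infty)$ is a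 dense element of $M$ ($y$ is dense if $y\wedge x=\bot$ implies $x=\bot$). $\mathcal E_0q=\{h\in\mathcal R_0L:\exists h'\in\mathcal D_0M\ (q\circ h'=h\circ p)\}$. *)

theory Defs
  imports "HOL-Analysis.Analysis"
begin

class frame = complete_lattice +
  assumes inf_Sup_frame: "inf a (Sup B) = (SUP b\<in>B. inf a b)"

instance complete_distrib_lattice \<subseteq> frame
  by standard (rule inf_Sup)

definition frame_hom :: "('a::frame \<Rightarrow> 'b::frame) \<Rightarrow> bool" where
  "frame_hom f \<longleftrightarrow>
     f top = top \<and> (\<forall>x y. f (inf x y) = inf (f x) (f y)) \<and> (\<forall>A. f (Sup A) = (SUP x\<in>A. f x))"

text \<open>The point of a pointed frame is an explicit argument; the frame 2 is the type \<^typ>\<open>bool\<close>.\<close>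

definition pointed_frame :: "('a::frame \<Rightarrow> bool) \<Rightarrow> bool" where
  "pointed_frame pt \<longleftrightarrow> frame_hom pt"

definition pointed_frame_hom ::
  "('a::frame \<Rightarrow> bool) \<Rightarrow> ('b::frame \<Rightarrow> bool) \<Rightarrow> ('a \<Rightarrow> 'b) \<Rightarrow> bool" where
  "pointed_frame_hom ptA ptB f \<longleftrightarrow> frame_hom f \<and> (\<forall>x. ptB (f x) = ptA x)"

definition dense_element :: "'a::frame \<Rightarrow> bool" where
  "dense_element y \<longleftrightarrow> (\<forall>x. inf y x = bot \<longrightarrow> x = bot)"

definition dense_map :: "('a::frame \<Rightarrow> 'b::frame) \<Rightarrow> bool" where
  "dense_map q \<longleftrightarrow> (\<forall>x. q x = bot \<longrightarrow> x = bot)"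

text \<open>Compactness and regularity are properties of the whole frame, hence of the type \<open>'a\<close>.\<close>

definition compact_frame :: "'a::frame itself \<Rightarrow> bool" where
  "compact_frame _ \<longleftrightarrow>
     (\<forall>A::'a set. Sup A = top \<longrightarrow> (\<exists>B\<subseteq>A. finite B \<and> Sup B = top))"

definition pseudocomplement :: "'a::frame \<Rightarrow> 'a" where
  "pseudocomplement x = Sup {z. inf x z = bot}"

definition rather_below :: "'a::frame \<Rightarrow> 'a \<Rightarrow> bool" where
  "rather_below y x \<longleftrightarrow> sup (pseudocomplement y) x = top"

definition regular_frame :: "'a::frame itself \<Rightarrow> bool" where
  "regular_frame _ \<longleftrightarrow> (\<forall>x::'a. x = Sup {y. rather_below y x})"

definition compactification ::
  "('m::frame \<Rightarrow> bool) \<Rightarrow> ('l::frame \<Rightarrow> bool) \<Rightarrow> ('m \<Rightarrow> 'l) \<Rightarrow> bool" where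
  "compactification ptM ptL q \<longleftrightarrow>
     pointed_frame ptM \<and> pointed_frame ptL \<and>
     pointed_frame_hom ptM ptL q \<and> dense_map q \<and> surj q \<and>
     compact_frame TYPE('m) \<and> regular_frame TYPE('m)"

typedef (overloaded) ('a::topological_space) opens = "{U::'a set. open U}"
  morphisms pts Opn by auto

setup_lifting type_definition_opens

instantiation opens :: (topological_space) complete_lattice
begin

lift_definition less_eq_opens :: "'a opens \<Rightarrow> 'a opens \<Rightarrow> bool" is "(\<subseteq>)" .
lift_definition less_opens :: "'a opens \<Rightarrow> 'a opens \<Rightarrow> bool" is "(\<subset>)" .
lift_definition inf_opens :: "'a opens \<Rightarrow> 'a opens \<Rightarrow> 'a opens" is "(\<inter>)" by auto
lift_definition sup_opens :: "'a opens \<Rightarrow> 'a opens \<Rightarrow> 'a opens" is "(\<union>)" by auto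
lift_definition top_opens :: "'a opens" is UNIV by auto
lift_definition bot_opens :: "'a opens" is "{}" by auto
lift_definition Sup_opens :: "'a opens set \<Rightarrow> 'a opens" is "\<lambda>A. \<Union>A" by auto
lift_definition Inf_opens :: "'a opens set \<Rightarrow> 'a opens" is "\<lambda>A. interior (\<Inter>A)" by auto

instance
proof
  fix x y z :: "'a opens" and A :: "'a opens set"
  show "x < y \<longleftrightarrow> x \<le> y \<and> \<not> y \<le> x" by transfer auto
  show "x \<le> x" by transfer auto
  show "x \<le> y \<Longrightarrow> y \<le> z \<Longrightarrow> x \<le> z" by transfer auto
  show "x \<le> y \<Longrightarrow> y \<le> x \<Longrightarrow> x = y" by transfer auto
  show "inf x y \<le> x" "inf x y \<le> y" by (transfer, auto)+
  show "x \<le> y \<Longrightarrow> x \<le> z \<Longrightarrow> x \<le> inf y z" by transfer auto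
  show "x \<le> sup x y" "y \<le> sup x y" by (transfer, auto)+
  show "y \<le> x \<Longrightarrow> z \<le> x \<Longrightarrow> sup y z \<le> x" by transfer auto
  show "x \<in> A \<Longrightarrow> Inf A \<le> x" unfolding less_eq_opens.rep_eq Inf_opens.rep_eq
    using interior_subset by fastforce
  show "(\<And>x. x \<in> A \<Longrightarrow> z \<le> x) \<Longrightarrow> z \<le> Inf A"
    unfolding less_eq_opens.rep_eq Inf_opens.rep_eq
    using pts by (intro interior_maximal) auto
  show "x \<in> A \<Longrightarrow> x \<le> Sup A"
    unfolding less_eq_opens.rep_eq Sup_opens.rep_eq by auto
  show "(\<And>x. x \<in> A \<Longrightarrow> x \<le> z) \<Longrightarrow> Sup A \<le> z"
    unfolding less_eq_opens.rep_eq Sup_opens.rep_eq by auto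
  show "Inf ({}::'a opens set) = top" by transfer auto
  show "Sup ({}::'a opens set) = bot" by transfer auto
qed

end

instance opens :: (topological_space) frame
proof
  fix a :: "'a opens" and B :: "'a opens set"
  show "inf a (Sup B) = (SUP b\<in>B. inf a b)"
    by (auto simp: pts_inject[symmetric] inf_opens.rep_eq Sup_opens.rep_eq)
qed

lift_definition zero_point :: "('a::{topological_space,zero}) opens \<Rightarrow> bool" is "\<lambda>U. 0 \<in> U" .

lift_definition restrict_opens :: "ereal opens \<Rightarrow> real opens" is "\<lambda>U. ereal -` U"
  by (auto intro: open_ereal_vimage)

lift_definition finite_part :: "ereal opens" is "{-\<infinity><..<\<infinity>}" by auto

lemma pointed_frame_zero_point: "pointed_frame zero_point"
  unfolding pointed_frame_def frame_hom_def
  by (auto simp: zero_point.rep_eq top_opens.rep_eq inf_opens.rep_eq Sup_opens.rep_eq)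

lemma pointed_frame_hom_restrict_opens:
  "pointed_frame_hom zero_point zero_point restrict_opens"
  unfolding pointed_frame_hom_def frame_hom_def
  by (auto simp: zero_point.rep_eq pts_inject[symmetric] restrict_opens.rep_eq zero_ereal_def
      top_opens.rep_eq inf_opens.rep_eq Sup_opens.rep_eq)

definition R0 :: "('l::frame \<Rightarrow> bool) \<Rightarrow> (real opens \<Rightarrow> 'l) set" where
  "R0 pt = {f. pointed_frame_hom zero_point pt f}"

text \<open>The action of an operation \<open>w\<close> of arity \<open>n\<close>. A point of the \<open>n\<close>-th power of \<^typ>\<open>real\<close>
  is an element of \<open>PiE {..<n} (\<lambda>_. UNIV)\<close>, with coordinates numbered from 0.\<close>

definition R_op ::
  "nat \<Rightarrow> ((nat \<Rightarrow> real) \<Rightarrow> real) \<Rightarrow> (nat \<Rightarrow> real opens \<Rightarrow> 'l::frame) \<Rightarrow> real opens \<Rightarrow> 'l" where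
  "R_op n w f V =
     Sup {INF i\<in>{..<n}. f i (U i) | U. w ` (PiE {..<n} (\<lambda>i. pts (U i))) \<subseteq> pts V}"

text \<open>The zero of the vector lattice is the operation of arity 0 with value 0.\<close>

definition R_zero :: "real opens \<Rightarrow> 'l::frame" where
  "R_zero = R_op 0 (\<lambda>_. 0) (\<lambda>_ _. top)"

definition R_scale :: "real \<Rightarrow> (real opens \<Rightarrow> 'l::frame) \<Rightarrow> real opens \<Rightarrow> 'l" where
  "R_scale c f = R_op 1 (\<lambda>x. c * x 0) (\<lambda>_. f)"

definition R_sup :: "(real opens \<Rightarrow> 'l::frame) \<Rightarrow> (real opens \<Rightarrow> 'l) \<Rightarrow> real opens \<Rightarrow> 'l" where
  "R_sup f g = R_op 2 (\<lambda>x. max (x 0) (x 1)) (\<lambda>i. if i = 0 then f else g)"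

definition R_trunc :: "(real opens \<Rightarrow> 'l::frame) \<Rightarrow> real opens \<Rightarrow> 'l" where
  "R_trunc f = R_op 1 (\<lambda>x. min (x 0) 1) (\<lambda>_. f)"

text \<open>The lattice order of the vector lattice, not the pointwise order of maps into \<open>'l\<close>.\<close>

definition R_le :: "(real opens \<Rightarrow> 'l::frame) \<Rightarrow> (real opens \<Rightarrow> 'l) \<Rightarrow> bool" where
  "R_le f g \<longleftrightarrow> R_sup f g = g"

definition R_trunc_at :: "nat \<Rightarrow> (real opens \<Rightarrow> 'l::frame) \<Rightarrow> real opens \<Rightarrow> 'l" where
  "R_trunc_at n h = R_scale (real n) (R_trunc (R_scale (1 / real n) h))"

lemma R_zero_apply: "R_zero V = (if zero_point V then top else bot)"
  unfolding R_zero_def R_op_def by (simp add: zero_point.rep_eq)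

lemma R_zero_in_R0:
  assumes "pointed_frame pt"
  shows "R_zero \<in> R0 pt"
proof -
  have "pt top" "\<not> pt bot"
    using assms unfolding pointed_frame_def frame_hom_def
    by (auto dest: spec[of _ "{}"])
  moreover have "frame_hom (R_zero :: real opens \<Rightarrow> 'a)"
    unfolding frame_hom_def R_zero_apply
  proof (intro conjI allI)
    fix A :: "real opens set"
    show "(if zero_point (Sup A) then top else bot :: 'a)
      = (SUP V\<in>A. if zero_point V then top else bot)"
    proof (cases "zero_point (Sup A)")
      case True
      then obtain V where "V \<in> A" "zero_point V"
        by (auto simp: zero_point.rep_eq Sup_opens.rep_eq)
      then have "top \<le> (SUP V\<in>A. if zero_point V then top else bot :: 'a)"
        by (intro SUP_upper2[of V]) auto
      then show ?thesis using True by (simp only: top_unique if_True)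
    next
      case False
      then have "\<And>V. V \<in> A \<Longrightarrow> \<not> zero_point V"
        by (auto simp: zero_point.rep_eq Sup_opens.rep_eq)
      then show ?thesis using False by simp
    qed
  qed (auto simp: zero_point.rep_eq top_opens.rep_eq inf_opens.rep_eq)
  ultimately show ?thesis
    unfolding R0_def pointed_frame_hom_def R_zero_apply by auto
qed

lemma R_op_unary:
  assumes "frame_hom f" and "continuous_on UNIV w"
  shows "R_op 1 (\<lambda>x. w (x 0)) (\<lambda>_. f) V = f (Opn (w -` pts V))"
proof -
  let ?W = "Opn (w -` pts V)"
  have "open (pts V)" using pts by blast
  then have W: "pts ?W = w -` pts V"
    using assms(2) by (simp add: Opn_inverse open_vimage)
  have mono: "f X \<le> f Y" if "X \<le> Y" for X Y
    using assms(1) that unfolding frame_hom_def by (metis inf.absorb_iff2 inf.commute)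
  have iff: "(\<lambda>x. w (x 0)) ` (PiE {..<1} (\<lambda>i. pts (U i))) \<subseteq> pts V \<longleftrightarrow> U 0 \<le> ?W"
    for U :: "nat \<Rightarrow> real opens"
  proof
    assume L: "(\<lambda>x. w (x 0)) ` (PiE {..<1} (\<lambda>i. pts (U i))) \<subseteq> pts V"
    have "w y \<in> pts V" if "y \<in> pts (U 0)" for y
      using subsetD[OF L, OF imageI, of "\<lambda>i. if i = 0 then y else undefined"] that
      by (auto simp: PiE_def extensional_def)
    then show "U 0 \<le> ?W" unfolding less_eq_opens.rep_eq W by auto
  qed (auto simp: less_eq_opens.rep_eq W)
  have "R_op 1 (\<lambda>x. w (x 0)) (\<lambda>_. f) V = Sup {f (U 0) |U :: nat \<Rightarrow> real opens. U 0 \<le> ?W}"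
    unfolding R_op_def iff by (simp add: lessThan_Suc)
  also have "\<dots> = f ?W"
    by (intro antisym Sup_least Sup_upper) (auto intro: mono exI[of _ "\<lambda>_. ?W"])
  finally show ?thesis .
qed

definition D0 :: "('m::frame \<Rightarrow> bool) \<Rightarrow> (ereal opens \<Rightarrow> 'm) set" where
  "D0 pt = {f. pointed_frame_hom zero_point pt f \<and> dense_element (f finite_part)}"

definition E0 ::
  "('m::frame \<Rightarrow> bool) \<Rightarrow> ('l::frame \<Rightarrow> bool) \<Rightarrow> ('m \<Rightarrow> 'l) \<Rightarrow> (real opens \<Rightarrow> 'l) set" where
  "E0 ptM ptL q = {h \<in> R0 ptL. \<exists>h'\<in>D0 ptM. q \<circ> h' = h \<circ> restrict_opens}"

end

theory Submission
  imports Defs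
begin

text \<open>
  For \<open>h \<ge> 0\<close> the truncation \<open>h \<and> n\<close> is \<open>h\<close> precomposed with the retraction of the extended line
  onto \<open>[-n, n]\<close>, so an extension \<open>h'\<close> restricts to the required factorizations.
  Conversely, a dense frame homomorphism is left cancellable on regular domains, hence the
  factorizations \<open>g n\<close> of the truncations are compatible. The extension \<open>h'\<close> takes \<open>U\<close> to the join
  of all \<open>g n V\<close> such that the preimage of \<open>V\<close> under the retraction onto \<open>[-n, n]\<close> lies in \<open>U\<close>.
  It preserves joins because a neighbourhood of an infinite point contains the preimage of a
  neighbourhood of \<open>n\<close> or \<open>-n\<close> for all large \<open>n\<close>.
\<close>

section \<open>Frame homomorphisms\<close>

lemma inf_sup_frame: "inf a (sup b c) = sup (inf a b) (inf a c)" for a :: "'a::frame"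
  using inf_Sup_frame[of a "{b, c}"] by simp

lemma frame_homD:
  assumes "frame_hom f"
  shows "f top = top" and "f (inf x y) = inf (f x) (f y)"
    and "f (Sup A) = (SUP x\<in>A. f x)" and "f (sup x y) = sup (f x) (f y)" and "f bot = bot"
proof -
  have Sup: "f (Sup B) = (SUP x\<in>B. f x)" for B
    using assms unfolding frame_hom_def by blast
  show "f top = top" "f (inf x y) = inf (f x) (f y)" "f (Sup A) = (SUP x\<in>A. f x)"
    using assms unfolding frame_hom_def by blast+
  show "f (sup x y) = sup (f x) (f y)" "f bot = bot"
    using Sup[of "{x, y}"] Sup[of "{}"] by simp_all
qed

lemma frame_hom_mono:
  assumes "frame_hom f" and "x \<le> y"
  shows "f x \<le> f y"
  using frame_homD(2)[OF assms(1), of x y] assms(2) by (metis inf.absorb_iff1)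

lemma frame_hom_comp: "frame_hom g \<Longrightarrow> frame_hom f \<Longrightarrow> frame_hom (g \<circ> f)"
  unfolding frame_hom_def by (simp add: image_image)

lemma frame_homI:
  assumes "f top = top" and "\<And>x y. x \<le> y \<Longrightarrow> f x \<le> f y"
    and "\<And>x y. inf (f x) (f y) \<le> f (inf x y)" and "\<And>A. f (Sup A) \<le> (SUP x\<in>A. f x)"
  shows "frame_hom f"
  unfolding frame_hom_def
  by (intro conjI allI antisym assms(1,3,4) le_infI SUP_least assms(2) Sup_upper) auto

text \<open>If \<open>a\<close> is rather below \<open>b\<close>, then \<open>q\<close> sends the
  meet of \<open>f a\<close> and \<open>g (pseudocomplement a)\<close> to \<open>bot\<close>,
  because \<open>q (f a) = q (g a)\<close>. By density this meet is \<open>bot\<close>, and since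
  \<open>g (pseudocomplement a)\<close> and \<open>g b\<close> join to \<open>top\<close>,
  \<open>f a\<close> lies below \<open>g b\<close>. Regularity recovers \<open>f b\<close> as the
  join of these \<open>f a\<close>; the roles of \<open>f\<close> and \<open>g\<close> are
  symmetric.\<close>

lemma dense_map_monic:
  fixes f g :: "'n::frame \<Rightarrow> 'm::frame"
  assumes "regular_frame TYPE('n)" and "frame_hom f" "frame_hom g"
    and "frame_hom q" "dense_map q" and "q \<circ> f = q \<circ> g"
  shows "f = g"
proof -
  have le: "f b \<le> g b"
    if hom: "frame_hom f" "frame_hom g" and eq: "q \<circ> f = q \<circ> g"
    for f g :: "'n \<Rightarrow> 'm" and b
  proof -
    have "f a \<le> g b" if "rather_below a b" for a
    proof -
      have "inf a (pseudocomplement a) = bot"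
        unfolding pseudocomplement_def inf_Sup_frame by (simp add: SUP_eq_iff)
      moreover have "q (f a) = q (g a)"
        using eq by (metis comp_apply)
      ultimately have "q (inf (f a) (g (pseudocomplement a))) = bot"
        using frame_homD(2,5)[OF \<open>frame_hom q\<close>] frame_homD(2,5)[OF hom(2)] by metis
      then have disj: "inf (f a) (g (pseudocomplement a)) = bot"
        using \<open>dense_map q\<close> unfolding dense_map_def by blast
      have "sup (g (pseudocomplement a)) (g b) = top"
        using that frame_homD(1,4)[OF hom(2)] unfolding rather_below_def by metis
      then have "f a = inf (f a) (sup (g (pseudocomplement a)) (g b))"
        by simp
      also have "\<dots> \<le> g b"
        unfolding inf_sup_frame disj by simp
      finally show ?thesis .
    qed
    moreover have "f b = (SUP a\<in>{a. rather_below a b}. f a)"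
      using \<open>regular_frame TYPE('n)\<close> frame_homD(3)[OF hom(1)]
      unfolding regular_frame_def by metis
    ultimately show ?thesis
      by (simp add: SUP_le_iff)
  qed
  show ?thesis
    using le[OF assms(2,3,6)] le[OF assms(3,2) assms(6)[symmetric]] by (intro ext antisym)
qed

section \<open>Frames of open sets\<close>

lemma open_pts [simp]: "open (pts U)"
  using pts by blast

lemma pts_Opn [simp]: "open U \<Longrightarrow> pts (Opn U) = U"
  by (simp add: Opn_inverse)

text \<open>Makes \<open>dense_map_monic\<close> applicable to maps out of the opens of the real
  line. If \<open>V\<close> around \<open>x\<close> and \<open>W\<close> around the complement of
  \<open>U\<close> are disjoint, then \<open>W\<close> lies below the pseudocomplement of
  \<open>V\<close>, so \<open>V\<close> is rather below \<open>U\<close>.\<close>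

lemma regular_frame_opens: "regular_frame TYPE('a::t3_space opens)"
  unfolding regular_frame_def
proof (intro allI antisym Sup_least)
  fix U V :: "'a opens"
  assume "V \<in> {V. rather_below V U}"
  then have "sup (pseudocomplement V) U = top"
    by (simp add: rather_below_def)
  then have "inf V (sup (pseudocomplement V) U) = V"
    by simp
  moreover have "inf V (pseudocomplement V) = bot"
    unfolding pseudocomplement_def inf_Sup_frame by (simp add: SUP_eq_iff)
  ultimately have "inf V U = V"
    unfolding inf_sup_frame by simp
  then show "V \<le> U"
    by (metis inf_le2)
next
  fix U :: "'a opens"
  have "x \<in> pts (Sup {V. rather_below V U})" if "x \<in> pts U" for x
  proof -
    have "\<exists>V W. open V \<and> open W \<and> x \<in> V \<and> - pts U \<subseteq> W \<and> V \<inter> W = {}"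
      using that closed_Compl[OF open_pts] by (intro t3_space) simp_all
    then obtain V W where VW: "open V" "open W" "x \<in> V" "- pts U \<subseteq> W" "V \<inter> W = {}"
      by blast
    have "inf (Opn V) (Opn W) = bot"
      unfolding pts_inject[symmetric] inf_opens.rep_eq bot_opens.rep_eq using VW by simp
    then have "Opn W \<le> pseudocomplement (Opn V)"
      unfolding pseudocomplement_def by (intro Sup_upper CollectI)
    then have "sup (Opn W) U \<le> sup (pseudocomplement (Opn V)) U"
      by (rule sup_mono) (rule order_refl)
    moreover have "sup (Opn W) U = top"
      unfolding pts_inject[symmetric] sup_opens.rep_eq top_opens.rep_eq pts_Opn[OF VW(2)]
      using VW(4) by blast
    ultimately have "rather_below (Opn V) U"
      unfolding rather_below_def by (simp only: top_unique)
    moreover have "x \<in> pts (Opn V)"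
      using VW by simp
    ultimately show ?thesis
      unfolding Sup_opens.rep_eq by blast
  qed
  then show "U \<le> Sup {V. rather_below V U}"
    unfolding less_eq_opens.rep_eq by blast
qed

text \<open>Preservation of joins turns an upper bound on \<open>f U\<close> into a local condition
  at the points of \<open>U\<close>; the neighbourhoods \<open>W\<close> may stick out of
  \<open>U\<close>.\<close>

lemma frame_hom_opens_le:
  assumes "frame_hom f" and "\<And>x. x \<in> pts U \<Longrightarrow> \<exists>W. x \<in> pts W \<and> f W \<le> s"
  shows "f U \<le> s"
proof -
  have "U \<le> Sup {W. f W \<le> s}"
    using assms(2) by (auto simp: less_eq_opens.rep_eq Sup_opens.rep_eq)
  then have "f U \<le> (SUP W\<in>{W. f W \<le> s}. f W)"
    using frame_hom_mono[OF assms(1)] frame_homD(3)[OF assms(1)] by metis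
  also have "\<dots> \<le> s"
    by (simp add: SUP_le_iff)
  finally show ?thesis .
qed

text \<open>The frame homomorphism dual to \<open>w\<close>. For discontinuous \<open>w\<close> the
  set may fail to be open, and then the value of \<open>Opn\<close> is unspecified.\<close>

definition vimage_opens :: "('a::topological_space \<Rightarrow> 'b::topological_space) \<Rightarrow> 'b opens \<Rightarrow> 'a opens"
  where "vimage_opens w V = Opn (w -` pts V)"

lemma pts_vimage_opens:
  "continuous_on UNIV w \<Longrightarrow> pts (vimage_opens w V) = w -` pts V"
  unfolding vimage_opens_def by (simp add: open_vimage)

lemma frame_hom_vimage_opens: "continuous_on UNIV w \<Longrightarrow> frame_hom (vimage_opens w)"
  unfolding frame_hom_def
  by (auto simp: pts_inject[symmetric] pts_vimage_opens
      top_opens.rep_eq inf_opens.rep_eq Sup_opens.rep_eq)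

lemma vimage_opens_comp:
  assumes "continuous_on UNIV v" and "continuous_on UNIV w"
  shows "vimage_opens v (vimage_opens w V) = vimage_opens (\<lambda>x. w (v x)) V"
proof -
  have "continuous_on UNIV (\<lambda>x. w (v x))"
    using continuous_on_compose2[OF assms(2,1)] by simp
  then show ?thesis
    by (auto simp: pts_inject[symmetric] pts_vimage_opens assms)
qed

lemma restrict_opens_eq: "restrict_opens U = vimage_opens ereal U"
  by (simp add: pts_inject[symmetric] restrict_opens.rep_eq pts_vimage_opens continuous_on_ereal)

section \<open>Nonnegative elements and their truncations\<close>

text \<open>Each unary operation acts by precomposition with a preimage map, and
  \<open>n * min (x / n) 1 = min x n\<close>.\<close>

lemma R_trunc_at_eq:
  assumes "frame_hom h" and "n > 0"
  shows "R_trunc_at n h V = h (vimage_opens (\<lambda>x. min x (real n)) V)"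
proof -
  have c: "continuous_on UNIV (\<lambda>x::real. a * x)" "continuous_on UNIV (\<lambda>x::real. min x 1)" for a
    by (intro continuous_intros)+
  have scale: "R_scale a f = f \<circ> vimage_opens (\<lambda>x. a * x)" if "frame_hom f"
    for a and f :: "real opens \<Rightarrow> 'a"
    unfolding R_scale_def using R_op_unary[OF that c(1)] by (auto simp: vimage_opens_def)
  have trunc: "R_trunc f = f \<circ> vimage_opens (\<lambda>x. min x 1)" if "frame_hom f"
    for f :: "real opens \<Rightarrow> 'a"
    unfolding R_trunc_def using R_op_unary[OF that c(2)] by (auto simp: vimage_opens_def)
  note hom = frame_hom_comp[OF _ frame_hom_vimage_opens]
  have "R_trunc_at n h V = h (vimage_opens (\<lambda>x. 1 / real n * x)
      (vimage_opens (\<lambda>x. min x 1) (vimage_opens (\<lambda>x. real n * x) V)))"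
    unfolding R_trunc_at_def
    by (simp add: scale trunc hom assms(1) c del: times_divide_eq_left)
  also have "\<dots> = h (vimage_opens (\<lambda>x. real n * min (1 / real n * x) 1) V)"
    by (subst vimage_opens_comp, intro continuous_intros, intro continuous_intros)+ simp
  also have "(\<lambda>x. real n * min (1 / real n * x) 1) = (\<lambda>x. min x (real n))"
    using \<open>n > 0\<close> by (auto simp: min_def field_simps)
  finally show ?thesis .
qed

text \<open>A nonnegative \<open>h\<close> vanishes on the negative half-line, so only the trace on
  \<open>[0, \<infinity>)\<close> counts. Indeed \<open>h\<close> is its own join with zero; if
  \<open>max\<close> maps a box into the negative reals, either its first side misses 0, where
  \<open>R_zero\<close> gives \<open>bot\<close>, or its second side is empty.\<close>

lemma R_le_zero_imp_eq:
  assumes "frame_hom h" and "R_le R_zero h"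
    and "\<And>x. x \<ge> 0 \<Longrightarrow> x \<in> pts V \<longleftrightarrow> x \<in> pts W"
  shows "h V = h W"
proof -
  let ?N = "Opn {..<0::real}"
  have "h ?N = R_sup R_zero h ?N"
    using assms(2) by (simp add: R_le_def)
  also have "\<dots> \<le> bot"
    unfolding R_sup_def R_op_def
  proof (intro Sup_least, clarify)
    fix U :: "nat \<Rightarrow> real opens"
    assume sub: "(\<lambda>x. max (x 0) (x 1)) ` (PiE {..<2} (\<lambda>i. pts (U i))) \<subseteq> pts ?N"
    show "(INF i\<in>{..<2}. (if i = 0 then R_zero else h) (U i)) \<le> bot"
    proof (cases "0 \<in> pts (U 0)")
      case True
      have "pts (U 1) = {}"
      proof (rule ccontr)
        assume "pts (U 1) \<noteq> {}"
        then obtain y where y: "y \<in> pts (U 1)"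
          by blast
        let ?x = "\<lambda>i::nat. if i = 0 then 0 else if i = 1 then y else undefined"
        have "?x \<in> PiE {..<2} (\<lambda>i. pts (U i))"
          using True y by (auto simp: PiE_def extensional_def less_2_cases_iff)
        from subsetD[OF sub imageI[OF this]] show False
          by simp
      qed
      then have "U 1 = bot"
        by (simp add: pts_inject[symmetric] bot_opens.rep_eq)
      then show ?thesis
        by (intro INF_lower2[of 1]) (simp_all add: frame_homD(5)[OF assms(1)])
    next
      case False
      then show ?thesis
        by (intro INF_lower2[of 0]) (simp_all add: R_zero_apply zero_point.rep_eq)
    qed
  qed
  finally have N: "h ?N = bot"
    by (simp add: bot_unique)
  have "x \<in> pts (sup V ?N) \<longleftrightarrow> x \<in> pts (sup W ?N)" for x
    using assms(3)[of x] by (cases "0 \<le> x") (auto simp: sup_opens.rep_eq)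
  then have "sup V ?N = sup W ?N"
    unfolding pts_inject[symmetric] by blast
  then have "sup (h V) (h ?N) = sup (h W) (h ?N)"
    using frame_homD(4)[OF assms(1)] by metis
  then show ?thesis
    by (simp add: N)
qed

section \<open>Cutting off the extended reals\<close>

text \<open>The retraction onto \<open>[-r, r]\<close> when \<open>r \<ge> 0\<close>. The cut at
  \<open>- r\<close> keeps the value finite at \<open>-\<infinity>\<close>; nonnegative
  \<open>h\<close> do not see it.\<close>

definition cutoff :: "real \<Rightarrow> ereal \<Rightarrow> real" where
  "cutoff r x = real_of_ereal (max (- ereal r) (min x (ereal r)))"

lemma ereal_cutoff: "r \<ge> 0 \<Longrightarrow> ereal (cutoff r x) = max (- ereal r) (min x (ereal r))"
  unfolding cutoff_def by (cases x) (auto simp: max_def min_def)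

lemma cutoff_ereal: "r \<ge> 0 \<Longrightarrow> cutoff r (ereal x) = max (- r) (min x r)"
  by (simp add: ereal_cutoff flip: ereal.inject ereal_max ereal_min)

lemma cutoff_infinity: "r \<ge> 0 \<Longrightarrow> cutoff r \<infinity> = r" "r \<ge> 0 \<Longrightarrow> cutoff r (-\<infinity>) = - r"
  unfolding cutoff_def by (auto simp: max_def min_def)

lemma cutoff_cutoff:
  assumes "0 \<le> r" and "r \<le> s"
  shows "cutoff r (ereal (cutoff s x)) = cutoff r x"
  using assms by (cases x) (auto simp: cutoff_ereal cutoff_infinity max_def min_def simp del: ereal_max ereal_min)

lemma cutoff_bounds:
  assumes "r \<ge> 0"
  shows "cutoff r x \<le> r" and "- r \<le> cutoff r x"
  using assms by (cases x; simp add: cutoff_ereal cutoff_infinity)+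

text \<open>The sign of \<open>a\<close> ensures that the lower cut \<open>- r\<close> alone cannot
  exceed \<open>a\<close>.\<close>

lemma less_cutoffD:
  assumes "r \<ge> 0" and "a \<ge> 0" and "a < cutoff r x"
  shows "ereal a < x"
  using assms by (cases x) (auto simp: cutoff_ereal cutoff_infinity less_max_iff_disj)

lemma cutoff_lessD:
  assumes "r \<ge> 0" and "b \<le> 0" and "cutoff r x < b"
  shows "x < ereal b"
  using assms by (cases x) (auto simp: cutoff_ereal cutoff_infinity min_less_iff_disj)

lemma cutoff_interior:
  assumes "r \<ge> 0" and "- r < cutoff r x" and "cutoff r x < r"
  shows "ereal (cutoff r x) = x"
  using assms(2,3) cutoff_infinity[OF assms(1)] cutoff_ereal[OF assms(1)]
  by (cases x) (auto simp: max_def min_def split: if_splits)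

lemma continuous_cutoff:
  assumes "r \<ge> 0"
  shows "continuous_on UNIV (cutoff r)"
proof -
  have "continuous_on UNIV (\<lambda>x. max (- ereal r) (min x (ereal r)))"
    by (intro continuous_intros)
  then have "continuous_on UNIV (\<lambda>x. ereal (cutoff r x))"
    by (simp add: ereal_cutoff assms)
  then show ?thesis
    using continuous_on_iff_ereal[of UNIV "cutoff r"] by (simp add: comp_def)
qed

lemma continuous_cutoff_ereal: "r \<ge> 0 \<Longrightarrow> continuous_on UNIV (\<lambda>x. cutoff r (ereal x))"
  using continuous_on_compose2[OF continuous_cutoff continuous_on_ereal[OF continuous_on_id]] by simp

lemma pts_vimage_cutoff: "r \<ge> 0 \<Longrightarrow> pts (vimage_opens (cutoff r) V) = cutoff r -` pts V"
  by (rule pts_vimage_opens[OF continuous_cutoff])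

lemma R_trunc_at_eq_cutoff:
  assumes "frame_hom h" and "R_le R_zero h" and "n > 0"
  shows "R_trunc_at n h V = h (vimage_opens (\<lambda>x. cutoff n (ereal x)) V)"
proof -
  have "continuous_on UNIV (\<lambda>x. min x (real n))"
    by (intro continuous_intros)
  note pts = pts_vimage_opens[OF this] pts_vimage_opens[OF continuous_cutoff_ereal[OF of_nat_0_le_iff]]
  show ?thesis
    unfolding R_trunc_at_eq[OF assms(1,3)]
    by (intro R_le_zero_imp_eq[OF assms(1,2)], unfold pts) (simp add: cutoff_ereal max_absorb2)
qed

section \<open>Extension to the extended reals\<close>

definition extension :: "(nat \<Rightarrow> real opens \<Rightarrow> 'm::frame) \<Rightarrow> ereal opens \<Rightarrow> 'm" where
  "extension g U = Sup {g n V | n V. n > 0 \<and> vimage_opens (cutoff n) V \<le> U}"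

lemma extension_upper:
  fixes g :: "nat \<Rightarrow> real opens \<Rightarrow> 'm::frame"
  shows "n > 0 \<Longrightarrow> vimage_opens (cutoff n) V \<le> U \<Longrightarrow> g n V \<le> extension g U"
  unfolding extension_def by (intro Sup_upper) blast

lemma extension_least:
  fixes g :: "nat \<Rightarrow> real opens \<Rightarrow> 'm::frame"
  shows "(\<And>n V. n > 0 \<Longrightarrow> vimage_opens (cutoff n) V \<le> U \<Longrightarrow> g n V \<le> s) \<Longrightarrow> extension g U \<le> s"
  unfolding extension_def by (intro Sup_least) blast

lemma extension_mono: "U \<le> U' \<Longrightarrow> extension g U \<le> extension g U'"
  by (intro extension_least extension_upper) auto

text \<open>Coherence moves finitely many levels to a common larger one, where \<open>g n\<close> is
  a homomorphism. At equal levels it says that \<open>g n V\<close> depends only on the trace of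
  \<open>V\<close> on \<open>[-n, n]\<close>.\<close>

lemma frame_hom_extension:
  assumes hom: "\<And>n. n > 0 \<Longrightarrow> frame_hom (g n)"
    and coherent: "\<And>m n V. 0 < m \<Longrightarrow> m \<le> n \<Longrightarrow>
      g m V = g n (vimage_opens (\<lambda>x. cutoff (real m) (ereal x)) V)"
  shows "frame_hom (extension g)"
proof (rule frame_homI)
  have "g 1 top \<le> extension g top"
    by (rule extension_upper) simp_all
  then show "extension g top = top"
    using frame_homD(1)[OF hom[of 1]] by (simp add: top_unique)
next
  fix U U' :: "ereal opens"
  have le: "inf (g m V) (g n W) \<le> extension g (inf A B)"
    if "0 < m" "m \<le> n" "vimage_opens (cutoff m) V \<le> A" "vimage_opens (cutoff n) W \<le> B"
    for m n V W A B
  proof -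
    \<comment> \<open>\<open>V\<close> transported to level \<open>n\<close>: by
      \<open>cutoff_cutoff\<close> its preimage under \<open>cutoff n\<close> is that of
      \<open>V\<close> under \<open>cutoff m\<close>.\<close>
    let ?V = "vimage_opens (\<lambda>x. cutoff m (ereal x)) V"
    have "inf (g m V) (g n W) = g n (inf ?V W)"
      using that frame_homD(2)[OF hom[of n]] coherent[of m n V] by simp
    also have "\<dots> \<le> extension g (inf A B)"
      using that
      by (intro extension_upper)
        (auto simp: less_eq_opens.rep_eq inf_opens.rep_eq pts_vimage_cutoff
          pts_vimage_opens continuous_cutoff_ereal cutoff_cutoff)
    finally show ?thesis .
  qed
  have elems: "inf (g m V) (g n W) \<le> extension g (inf U U')"
    if "0 < m" "0 < n" "vimage_opens (cutoff m) V \<le> U" "vimage_opens (cutoff n) W \<le> U'"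
    for m n V W
    using le[of m n V U W U'] le[of n m W U' V U] that by (cases "m \<le> n") (auto simp: inf.commute)
  have "inf (extension g U') (g m V) \<le> extension g (inf U U')"
    if "0 < m" "vimage_opens (cutoff m) V \<le> U" for m V
    unfolding inf.commute[of _ "g m V"] extension_def[of g U'] inf_Sup_frame
    using that elems by (intro SUP_least) blast
  then have "inf (extension g U') (extension g U) \<le> extension g (inf U U')"
    unfolding extension_def[of g U] inf_Sup_frame by (intro SUP_least) blast
  then show "inf (extension g U) (extension g U') \<le> extension g (inf U U')"
    by (simp only: inf.commute[of "extension g U"])
next
  fix A :: "ereal opens set"
  let ?s = "SUP U\<in>A. extension g U"
  show "extension g (Sup A) \<le> ?s"
  proof (rule extension_least)
    fix n :: nat and V
    assume "n > 0" and V: "vimage_opens (cutoff n) V \<le> Sup A"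
    have V_sub: "\<exists>U\<in>A. y \<in> pts U" if "cutoff n y \<in> pts V" for y
      using V that unfolding less_eq_opens.rep_eq Sup_opens.rep_eq pts_vimage_cutoff[OF of_nat_0_le_iff] by blast
    \<comment> \<open>If the infinite point is not covered, any bound will do.\<close>
    obtain a where a: "\<infinity> \<in> pts (Sup A) \<Longrightarrow> \<exists>U\<in>A. {ereal a<..} \<subseteq> pts U"
      unfolding Sup_opens.rep_eq by (meson UN_E open_PInfty open_pts)
    obtain b where b: "-\<infinity> \<in> pts (Sup A) \<Longrightarrow> \<exists>U\<in>A. {..<ereal b} \<subseteq> pts U"
      unfolding Sup_opens.rep_eq by (meson UN_E open_MInfty open_pts)
    \<comment> \<open>Beyond \<open>a\<close> and \<open>b\<close> a single member of the cover contains everything, so at level \<open>N\<close> also the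
      end points \<open>N\<close> and \<open>-N\<close> have a neighbourhood whose preimage lies in one member.\<close>
    obtain N :: nat where "real N > max (real n) (max a (- b))"
      using reals_Archimedean2 by blast
    then have N: "n \<le> N" "a < N" "- real N < b" "N > 0"
      using \<open>n > 0\<close> by auto
    have cover: "g N W \<le> ?s" if "U \<in> A" "\<And>y. cutoff N y \<in> pts W \<Longrightarrow> y \<in> pts U" for U W
    proof -
      have "g N W \<le> extension g U"
        using that N by (intro extension_upper) (auto simp: less_eq_opens.rep_eq pts_vimage_cutoff)
      also have "\<dots> \<le> ?s"
        using that by (intro SUP_upper)
      finally show ?thesis .
    qed
    have empty: "g N W \<le> ?s" if "\<And>y. cutoff N y \<notin> pts W" for W
    proof -
      \<comment> \<open>Coherence from level \<open>N\<close> to itself replaces \<open>W\<close> by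
        this empty preimage.\<close>
      have "vimage_opens (\<lambda>x. cutoff N (ereal x)) W = bot"
        using that by (auto simp: pts_inject[symmetric] pts_vimage_opens continuous_cutoff_ereal
            bot_opens.rep_eq)
      then have "g N W = bot"
        using coherent[of N N W] N frame_homD(5)[OF hom[of N]] by simp
      then show ?thesis
        by simp
    qed
    have "g n V = g N (vimage_opens (\<lambda>x. cutoff n (ereal x)) V)"
      using coherent \<open>n > 0\<close> N by blast
    also have "\<dots> \<le> ?s"
    proof (rule frame_hom_opens_le)
      show "frame_hom (g N)"
        using hom N by blast
      fix x
      assume "x \<in> pts (vimage_opens (\<lambda>x. cutoff n (ereal x)) V)"
      then have x: "cutoff n (ereal x) \<in> pts V"
        by (simp add: pts_vimage_opens continuous_cutoff_ereal)
      consider "x > N" | "x < - real N" | "x = N" | "x = - real N" | "- real N < x" "x < N"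
        by linarith
      then show "\<exists>W. x \<in> pts W \<and> g N W \<le> ?s"
      proof cases
        case 1
        then show ?thesis
          by (intro exI[of _ "Opn {real N<..}"] conjI empty) (simp_all add: not_less cutoff_bounds)
      next
        case 2
        then show ?thesis
          by (intro exI[of _ "Opn {..<- real N}"] conjI empty) (simp_all add: not_less cutoff_bounds)
      next
        case 3
        \<comment> \<open>As \<open>n \<le> N\<close>, both \<open>N\<close> and
          \<open>\<infinity>\<close> are cut to \<open>n\<close>, so \<open>\<infinity>\<close> is
          covered by \<open>A\<close>.\<close>
        then have "cutoff n \<infinity> \<in> pts V"
          using x N by (simp add: cutoff_infinity cutoff_ereal)
        then obtain U where U: "U \<in> A" "{ereal a<..} \<subseteq> pts U"
          using a V_sub by (auto simp: Sup_opens.rep_eq)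
        \<comment> \<open>The 0 meets the sign condition of \<open>less_cutoffD\<close>;
          \<open>N\<close> still exceeds \<open>max a 0\<close>.\<close>
        have "y \<in> pts U" if "cutoff N y \<in> {max a 0<..}" for y
          using less_cutoffD[of N "max a 0" y] that U(2) by fastforce
        then show ?thesis
          using 3 N U by (intro exI[of _ "Opn {max a 0<..}"] conjI cover[of U]) auto
      next
        case 4
        then have "cutoff n (-\<infinity>) \<in> pts V"
          using x N by (simp add: cutoff_infinity cutoff_ereal)
        then obtain U where U: "U \<in> A" "{..<ereal b} \<subseteq> pts U"
          using b V_sub by (auto simp: Sup_opens.rep_eq)
        have "y \<in> pts U" if "cutoff N y \<in> {..<min b 0}" for y
          using cutoff_lessD[of N "min b 0" y] that U(2) by fastforce
        then show ?thesis
          using 4 N U by (intro exI[of _ "Opn {..<min b 0}"] conjI cover[of U]) auto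
      next
        case 5
        obtain U where U: "U \<in> A" "ereal x \<in> pts U"
          using V_sub[OF x] by blast
        \<comment> \<open>Strictly between the end points nothing is cut, so the preimage of this
          set stays inside \<open>U\<close>.\<close>
        let ?W = "{- real N<..<real N} \<inter> ereal -` pts U"
        have "open ?W"
          by (intro open_Int open_greaterThanLessThan open_ereal_vimage open_pts)
        moreover have "y \<in> pts U" if "cutoff N y \<in> ?W" for y
          using that cutoff_interior[of N y] by simp
        ultimately show ?thesis
          using 5 U by (intro exI[of _ "Opn ?W"] conjI cover[of U]) auto
      qed
    qed
    finally show "g n V \<le> ?s" .
  qed
qed (rule extension_mono)

text \<open>Every real point lies strictly inside some \<open>[-n, n]\<close>, and
  \<open>cutoff n\<close> leaves its small neighbourhoods unchanged, so the levels together recover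
  \<open>h\<close> on the finite part of \<open>U\<close>.\<close>

lemma comp_extension:
  fixes q :: "'m::frame \<Rightarrow> 'l::frame"
  assumes "frame_hom q" and "frame_hom h"
    and g: "\<And>n V. n > 0 \<Longrightarrow> q (g n V) = h (vimage_opens (\<lambda>x. cutoff (real n) (ereal x)) V)"
  shows "q (extension g U) = h (restrict_opens U)"
proof (rule antisym)
  have "q (g n V) \<le> h (restrict_opens U)" if "n > 0" "vimage_opens (cutoff n) V \<le> U" for n V
    unfolding g[OF that(1)] using that
    by (intro frame_hom_mono[OF assms(2)])
      (auto simp: less_eq_opens.rep_eq restrict_opens.rep_eq pts_vimage_cutoff
        pts_vimage_opens continuous_cutoff_ereal)
  then show "q (extension g U) \<le> h (restrict_opens U)"
    unfolding extension_def frame_homD(3)[OF assms(1)] by (auto simp: SUP_le_iff)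
next
  show "h (restrict_opens U) \<le> q (extension g U)"
  proof (rule frame_hom_opens_le[OF assms(2)])
    fix x
    assume x: "x \<in> pts (restrict_opens U)"
    obtain n :: nat where n: "\<bar>x\<bar> < n"
      using reals_Archimedean2 by blast
    let ?W = "{- real n<..<real n} \<inter> ereal -` pts U"
    have W: "open ?W"
      by (intro open_Int open_greaterThanLessThan open_ereal_vimage open_pts)
    have "y \<in> pts U" if "cutoff n y \<in> ?W" for y
      using that cutoff_interior[of n y] by simp
    then have "q (g n (Opn ?W)) \<le> q (extension g U)"
      using n W by (intro frame_hom_mono[OF assms(1)] extension_upper)
        (auto simp: less_eq_opens.rep_eq pts_vimage_cutoff)
    moreover have "cutoff n (ereal y) \<in> ?W \<longleftrightarrow> y \<in> ?W" for y
      using cutoff_interior[of n "ereal y"] cutoff_ereal[of n y] by auto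
    then have "vimage_opens (\<lambda>x. cutoff n (ereal x)) (Opn ?W) = Opn ?W"
      unfolding pts_inject[symmetric] pts_vimage_opens[OF continuous_cutoff_ereal[OF of_nat_0_le_iff]]
        pts_Opn[OF W] by blast
    ultimately have "h (Opn ?W) \<le> q (extension g U)"
      using g[of n "Opn ?W"] n by simp
    then show "\<exists>W. x \<in> pts W \<and> h W \<le> q (extension g U)"
      using x n W by (intro exI[of _ "Opn ?W"]) (auto simp: restrict_opens.rep_eq)
  qed
qed

theorem proposition5p4p1:
  fixes ptM :: "'m::frame \<Rightarrow> bool" and ptL :: "'l::frame \<Rightarrow> bool"
    and q :: "'m \<Rightarrow> 'l" and h :: "real opens \<Rightarrow> 'l"
  assumes "compactification ptM ptL q"
    and "h \<in> R0 ptL"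
    and "R_le R_zero h"
  shows "h \<in> E0 ptM ptL q \<longleftrightarrow>
    (\<forall>n::nat. n > 0 \<longrightarrow> (\<exists>hn\<in>R0 ptM. R_trunc_at n h = q \<circ> hn))"
proof
  have q: "frame_hom q" "dense_map q" "\<And>x. ptL (q x) = ptM x"
    using assms(1) unfolding compactification_def pointed_frame_hom_def by auto
  have h: "frame_hom h" "\<And>V. ptL (h V) = zero_point V"
    using assms(2) unfolding R0_def pointed_frame_hom_def by auto
  note trunc = R_trunc_at_eq_cutoff[OF h(1) assms(3)]
  {
    assume "h \<in> E0 ptM ptL q"
    then obtain h' where h': "frame_hom h'" "\<And>U. ptM (h' U) = zero_point U"
      and eq: "q \<circ> h' = h \<circ> restrict_opens"
      unfolding E0_def D0_def pointed_frame_hom_def by auto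
    show "\<forall>n::nat. n > 0 \<longrightarrow> (\<exists>hn\<in>R0 ptM. R_trunc_at n h = q \<circ> hn)"
    proof (intro allI impI bexI)
      fix n :: nat
      assume "n > 0"
      show "R_trunc_at n h = q \<circ> (h' \<circ> vimage_opens (cutoff n))"
        unfolding comp_assoc[symmetric] eq
        by (auto simp: fun_eq_iff trunc[OF \<open>n > 0\<close>] restrict_opens_eq vimage_opens_comp
            continuous_cutoff continuous_on_ereal)
      \<comment> \<open>Fixing 0 makes the preimage map compatible with the points.\<close>
      have "cutoff n 0 = 0"
        using cutoff_ereal[of n 0] by (simp add: zero_ereal_def)
      then show "h' \<circ> vimage_opens (cutoff n) \<in> R0 ptM"
        unfolding R0_def pointed_frame_hom_def
        by (auto intro!: frame_hom_comp frame_hom_vimage_opens continuous_cutoff h'(1)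
            simp: h'(2) zero_point.rep_eq pts_vimage_cutoff)
    qed
  next
    assume "\<forall>n::nat. n > 0 \<longrightarrow> (\<exists>hn\<in>R0 ptM. R_trunc_at n h = q \<circ> hn)"
    then obtain g where "\<And>n::nat. n > 0 \<Longrightarrow> g n \<in> R0 ptM \<and> R_trunc_at n h = q \<circ> g n"
      by metis
    then have g: "frame_hom (g n)" "q \<circ> g n = R_trunc_at n h" if "n > 0" for n
      using that unfolding R0_def pointed_frame_hom_def by auto
    have qg: "q (g n V) = h (vimage_opens (\<lambda>x. cutoff (real n) (ereal x)) V)" if "n > 0" for n V
      using g(2)[OF that] trunc[OF that] by (metis comp_apply)
    have coherent: "g m V = g n (vimage_opens (\<lambda>x. cutoff (real m) (ereal x)) V)"
      if "0 < m" "m \<le> n" for m n V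
    proof -
      \<comment> \<open>After composition with \<open>q\<close> both sides are \<open>h\<close>
        along \<open>cutoff m\<close>, by \<open>cutoff_cutoff\<close>; density of \<open>q\<close>
        cancels it.\<close>
      have "g m = g n \<circ> vimage_opens (\<lambda>x. cutoff (real m) (ereal x))"
        using that
        by (intro dense_map_monic[OF regular_frame_opens _ _ q(1,2)] frame_hom_comp
            frame_hom_vimage_opens continuous_cutoff_ereal g(1))
          (auto simp: fun_eq_iff qg vimage_opens_comp continuous_cutoff_ereal cutoff_cutoff)
      then show ?thesis
        by simp
    qed
    let ?h' = "extension g"
    have hom: "frame_hom ?h'"
      by (rule frame_hom_extension[OF g(1) coherent])
    have eq: "q (?h' U) = h (restrict_opens U)" for U
      by (rule comp_extension[OF q(1) h(1) qg])
    \<comment> \<open>The point of \<open>M\<close> factors through \<open>q\<close>, so this is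
      read off in \<open>L\<close>.\<close>
    have "ptM (?h' U) = zero_point U" for U
      by (simp add: q(3)[symmetric] eq h(2) zero_point.rep_eq restrict_opens.rep_eq zero_ereal_def)
    moreover have "restrict_opens finite_part = top"
      by (auto simp: pts_inject[symmetric] restrict_opens.rep_eq finite_part.rep_eq top_opens.rep_eq)
    then have "q (?h' finite_part) = top"
      by (simp add: eq frame_homD(1)[OF h(1)])
    \<comment> \<open>If \<open>x\<close> meets this element in \<open>bot\<close>, then
      \<open>q x = bot\<close>, since \<open>q\<close> sends the element to \<open>top\<close>;
      hence \<open>x = bot\<close>.\<close>
    then have "dense_element (?h' finite_part)"
      using q(2) frame_homD(2,5)[OF q(1)] unfolding dense_element_def dense_map_def
      by (metis inf_top_left)
    ultimately show "h \<in> E0 ptM ptL q"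
      using assms(2) hom eq unfolding E0_def D0_def pointed_frame_hom_def
      by (auto simp: fun_eq_iff intro!: exI[of _ ?h'])
  }
qed

end
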